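(* There is an $\mathsf{n}$-simple model $M$ such that no $M$-predicate $H$ satisfies $\Phi_M(H)=\mathrm{False}_M$ (i.e. $M$ satisfies F-Tarski), but some $M$-predicate $H$ satisfies $\Phi_M(H)=\mathrm{True}_M$ (i.e. $M$ does not satisfy T-Tarski).
   Context: For a non-empty set $\Sigma$ of symbols, $\Sigma^\ast$ is the set of all finite strings over $\Sigma$, including the empty string; $XY$ denotes concatenation. Fix distinct symbols $\mathsf{n},\mathsf{r},\sharp$. A simple model is a pair $M=(\Sigma_M,\Phi_M)$ where $\Sigma_M$ is a set of symbols with $\sharp\in\Sigma_M$, and, putting $\mathrm{Pred}_M=\{X\sharp : X\in\Sigma_M^\ast \text{ and } X \text{ does not contain } \sharp\}$, $\Phi_M$ is a function $\mathrm{Pred}_M\to\mathcal{P}(\Sigma_M^\ast)$. Elements of $\mathrm{Pred}_M$ are called $M$-predicates. $\mathrm{Sent}_M=\{HX : H\in\mathrm{Pred}_M, X\in\Sigma_M^\ast\}$ is the set of $M$-sentences (the decomposition $HX$ is unique). $\mathrm{True}_M=\{HX\in\mathrm{Sent}_M : H\in\mathrm{Pred}_M, X\in\Phi_M(H)\}$ and $\mathrm{False}_M=\mathrm{Sent}_M\setminus\mathrm{True}_M$. A simple model $M$ is an $\mathsf{n}$-simple model if $\mathsf{n}\in\Sigma_M$ and for each $H\in\mathrm{Pred}_M$ we have $\mathsf{n}H\in\mathrm{Pred}_M$ and $\Phi_M(\mathsf{n}H)=\Sigma_M^\ast\setminus\Phi_M(H)$. *)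

theory Defs
  imports Main "HOL-Library.FuncSet"
begin

text \<open>
  Symbols are the elements of an arbitrary type \<open>'a\<close>, and the set of strings over \<open>\<Sigma>\<close> is
  \<open>lists \<Sigma>\<close>. The fixed symbols are parameters, called \<open>sharp\<close> and \<open>n\<close> below.
\<close>

record 'a model =
  symbols :: "'a set"
  val :: "'a list \<Rightarrow> 'a list set"

definition Pred :: "'a \<Rightarrow> 'a model \<Rightarrow> 'a list set" where
  "Pred sharp M = {X @ [sharp] | X. X \<in> lists (symbols M) \<and> sharp \<notin> set X}"

text \<open>
  The extensional function space makes \<open>val M\<close> a function with domain exactly the set of
  predicates: it is \<open>undefined\<close> elsewhere.
\<close>

definition simple_model :: "'a \<Rightarrow> 'a model \<Rightarrow> bool" where
  "simple_model sharp M \<longleftrightarrow>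
     sharp \<in> symbols M \<and> val M \<in> Pred sharp M \<rightarrow>\<^sub>E Pow (lists (symbols M))"

definition Sent :: "'a \<Rightarrow> 'a model \<Rightarrow> 'a list set" where
  "Sent sharp M = {H @ X | H X. H \<in> Pred sharp M \<and> X \<in> lists (symbols M)}"

definition True_sents :: "'a \<Rightarrow> 'a model \<Rightarrow> 'a list set" where
  "True_sents sharp M =
     {H @ X | H X. H @ X \<in> Sent sharp M \<and> H \<in> Pred sharp M \<and> X \<in> val M H}"

definition False_sents :: "'a \<Rightarrow> 'a model \<Rightarrow> 'a list set" where
  "False_sents sharp M = Sent sharp M - True_sents sharp M"

definition n_simple_model :: "'a \<Rightarrow> 'a \<Rightarrow> 'a model \<Rightarrow> bool" where
  "n_simple_model sharp n M \<longleftrightarrow>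
     simple_model sharp M \<and> n \<in> symbols M \<and>
     (\<forall>H \<in> Pred sharp M. n # H \<in> Pred sharp M \<and>
        val M (n # H) = lists (symbols M) - val M H)"

end

theory Submission imports Defs begin

text \<open>
  Over the alphabet \<open>{n, \<sharp>}\<close> every predicate has the form \<open>n\<^sup>k\<sharp>\<close>. Let \<open>\<sharp>\<close> itself denote truth: then \<open>\<sharp>X\<close>
  is true iff \<open>X\<close> is, and \<open>n\<^sup>k\<sharp>X\<close> is true iff this holds after \<open>k\<close> negations, which determines
  truth by recursion on the string. The only extensions are the set of truths and its complement
  in the set of all strings. The latter contains the empty string, which is not a sentence,
  so neither is the set of falsehoods.
\<close>

text \<open>Every symbol other than \<open>s\<close> acts as a negation. The guard
  \<open>s \<in> set Y\<close> keeps strings without \<open>s\<close>, which are not sentences,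
  untrue; bare negation would make \<open>[n]\<close> true.\<close>

primrec truth :: "'a \<Rightarrow> 'a list \<Rightarrow> bool" where
  "truth s [] \<longleftrightarrow> False"
| "truth s (x # Y) \<longleftrightarrow> (if x = s then truth s Y else s \<in> set Y \<and> \<not> truth s Y)"

lemma truth_imp_mem: "truth s Y \<Longrightarrow> s \<in> set Y"
  by (cases Y) (auto split: if_splits)

text \<open>The \<open>s\<close> after \<open>P\<close> satisfies the guard at each symbol of
  \<open>P\<close>, so each one negates, while \<open>s\<close> itself changes nothing. Only the
  parity of \<open>P\<close> matters.\<close>

lemma truth_append:
  "s \<notin> set P \<Longrightarrow> truth s (P @ s # X) \<longleftrightarrow> (truth s X \<longleftrightarrow> even (length P))"
  by (induction P) auto

text \<open>The domain of \<open>val\<close> is the set of predicates, spelled out because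
  \<open>Pred\<close> takes the finished model as argument.\<close>

definition truth_model :: "'a \<Rightarrow> 'a \<Rightarrow> 'a model" where
  "truth_model s n = \<lparr>symbols = {n, s},
     val = (\<lambda>H \<in> {X @ [s] | X. X \<in> lists {n, s} \<and> s \<notin> set X}.
              {X \<in> lists {n, s}. truth s (H @ X)})\<rparr>"

lemma symbols_truth_model [simp]: "symbols (truth_model s n) = {n, s}"
  by (simp add: truth_model_def)

lemma val_truth_model:
  "H \<in> Pred s (truth_model s n) \<Longrightarrow>
     val (truth_model s n) H = {X \<in> lists {n, s}. truth s (H @ X)}"
  by (simp add: truth_model_def Pred_def)

lemma simple_model_truth_model: "simple_model s (truth_model s n)"
  unfolding simple_model_def
proof (intro conjI PiE_I)
  fix H assume "H \<notin> Pred s (truth_model s n)"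
  then show "val (truth_model s n) H = undefined"
    unfolding truth_model_def Pred_def by (simp only: model.simps restrict_apply if_False)
qed (auto simp: val_truth_model)

lemma n_simple_model_truth_model:
  assumes "n \<noteq> s"
  shows "n_simple_model s n (truth_model s n)"
  unfolding n_simple_model_def
proof (intro conjI ballI)
  fix H assume H: "H \<in> Pred s (truth_model s n)"
  then obtain P where P: "H = P @ [s]" "P \<in> lists {n, s}" "s \<notin> set P"
    by (auto simp: Pred_def)
  have "n # H = (n # P) @ [s]" "n # P \<in> lists {n, s}" "s \<notin> set (n # P)"
    using P assms by auto
  then show nH: "n # H \<in> Pred s (truth_model s n)"
    unfolding Pred_def by auto
  \<comment> \<open>As \<open>H\<close> contains \<open>s\<close> and \<open>n \<noteq> s\<close>,
    the negating clause of \<open>truth\<close> applies to \<open>n # H @ X\<close> with its guard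
    satisfied.\<close>
  show "val (truth_model s n) (n # H) =
      lists (symbols (truth_model s n)) - val (truth_model s n) H"
    using H nH P assms by (auto simp: val_truth_model)
qed (simp_all add: simple_model_truth_model)

text \<open>Cutting a string just after its first \<open>s\<close> splits off a predicate.\<close>

lemma Sent_eq:
  assumes "s \<in> symbols M"
  shows "Sent s M = {Y \<in> lists (symbols M). s \<in> set Y}"
proof (intro equalityI subsetI)
  fix Y assume Y: "Y \<in> {Y \<in> lists (symbols M). s \<in> set Y}"
  then obtain P X where "Y = P @ s # X" "s \<notin> set P"
    by (auto dest: split_list_first)
  with Y have "Y = (P @ [s]) @ X" "P @ [s] \<in> Pred s M" "X \<in> lists (symbols M)"
    by (auto simp: Pred_def)
  then show "Y \<in> Sent s M"
    unfolding Sent_def by blast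
next
  fix Y assume "Y \<in> Sent s M"
  with assms show "Y \<in> {Y \<in> lists (symbols M). s \<in> set Y}"
    by (auto simp: Sent_def Pred_def)
qed

text \<open>Truth in the model agrees with the recursion that defines \<open>val\<close>: by
  \<open>truth_imp_mem\<close> a true string contains \<open>s\<close>, hence splits into a
  predicate and an argument.\<close>

lemma True_sents_truth_model:
  "True_sents s (truth_model s n) = {Y \<in> lists {n, s}. truth s Y}"
proof (intro equalityI subsetI)
  fix Y assume "Y \<in> True_sents s (truth_model s n)"
  then obtain H X where "Y = H @ X" "H \<in> Pred s (truth_model s n)"
      "X \<in> val (truth_model s n) H"
    by (auto simp: True_sents_def)
  then show "Y \<in> {Y \<in> lists {n, s}. truth s Y}"
    by (auto simp: val_truth_model) (auto simp: Pred_def)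
next
  fix Y assume Y: "Y \<in> {Y \<in> lists {n, s}. truth s Y}"
  then have "Y \<in> Sent s (truth_model s n)"
    by (simp add: Sent_eq truth_imp_mem)
  then obtain H X where HX: "Y = H @ X" "H \<in> Pred s (truth_model s n)" "X \<in> lists {n, s}"
    by (auto simp: Sent_def)
  with Y have "X \<in> val (truth_model s n) H"
    by (simp add: val_truth_model)
  with HX \<open>Y \<in> Sent s (truth_model s n)\<close> show "Y \<in> True_sents s (truth_model s n)"
    unfolding True_sents_def by blast
qed

theorem proposition4p9:
  fixes n r sharp :: 'a
  assumes "distinct [n, r, sharp]"
  shows "\<exists>M :: 'a model. n_simple_model sharp n M \<and>
           \<not> (\<exists>H \<in> Pred sharp M. val M H = False_sents sharp M) \<and>
           (\<exists>H \<in> Pred sharp M. val M H = True_sents sharp M)"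
proof (intro exI conjI)
  let ?M = "truth_model sharp n"
  show "n_simple_model sharp n ?M"
    using assms by (intro n_simple_model_truth_model) auto
  have False_eq: "False_sents sharp ?M =
      {Y \<in> lists {n, sharp}. sharp \<in> set Y \<and> \<not> truth sharp Y}"
    by (auto simp: False_sents_def Sent_eq True_sents_truth_model)
  show "\<not> (\<exists>H \<in> Pred sharp ?M. val ?M H = False_sents sharp ?M)"
  proof
    assume "\<exists>H \<in> Pred sharp ?M. val ?M H = False_sents sharp ?M"
    then obtain H where H: "H \<in> Pred sharp ?M" "val ?M H = False_sents sharp ?M"
      by blast
    then obtain P where P: "H = P @ [sharp]" "sharp \<notin> set P"
      by (auto simp: Pred_def)
    have truth_iff: "truth sharp (P @ sharp # X) \<longleftrightarrow> sharp \<in> set X \<and> \<not> truth sharp X"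
      if "X \<in> lists {n, sharp}" for X
    proof -
      have "X \<in> val ?M H \<longleftrightarrow> truth sharp (P @ sharp # X)"
        using that unfolding val_truth_model[OF H(1)] by (simp add: P(1))
      moreover have "X \<in> val ?M H \<longleftrightarrow> sharp \<in> set X \<and> \<not> truth sharp X"
        using that by (simp add: H(2) False_eq)
      ultimately show ?thesis by blast
    qed
    \<comment> \<open>Neither \<open>[]\<close> nor \<open>[sharp]\<close> is true, so
      \<open>truth_append\<close> treats them alike; but only \<open>[sharp]\<close> is a sentence,
      hence a falsehood. The two demand opposite parities of \<open>P\<close>.\<close>
    have "even (length P)"
      using truth_iff[of "[]"] truth_append[OF P(2), of "[]"] by simp
    moreover have "odd (length P)"
      using truth_iff[of "[sharp]"] truth_append[OF P(2), of "[sharp]"] by simp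
    ultimately show False by blast
  qed
  \<comment> \<open>The truth predicate is \<open>[sharp]\<close>, since a leading
    \<open>sharp\<close> leaves truth unchanged.\<close>
  have sharp: "[sharp] \<in> Pred sharp ?M"
    by (auto simp: Pred_def)
  then have "val ?M [sharp] = True_sents sharp ?M"
    by (simp add: val_truth_model True_sents_truth_model)
  with sharp show "\<exists>H \<in> Pred sharp ?M. val ?M H = True_sents sharp ?M"
    by blast
qed

end
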